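(* Let $A$ be an $n\times n$ complex matrix and let $P(w)=\prod_{\ell=1}^{p}(w-w_{\ell})$ be a polynomial with complex roots listed in a chosen order such that $P(A)=0$. For $k=0,\dots,p$ set $E_{k}=\prod_{\ell=1}^{k}(A-w_{\ell})\,\mathbb{C}^n$ and $N_{k}=\dim E_{k}$ (so $N_0=n$ and $N_p=0$), and for $1\le \ell\le p-1$ set $\lambda_{\ell}=w_{\ell+1}-w_{\ell}$. Fix $j$ with $1\le j\le p-1$ and $\lambda_j\neq 0$ (i.e. $w_j\neq w_{j+1}$), and let $(N'_k)$, $(\lambda'_\ell)$ denote the same quantities computed from the reordered factorization in which the $j$-th and $(j+1)$-th linear factors $(w-w_j)$ and $(w-w_{j+1})$ are interchanged. Then $$N'_k=N_k\ (k\neq j),\qquad N'_j=N_{j-1}+N_{j+1}-N_j,$$ that is, the dimension vector changes by the simple Weyl reflection at the node $j$ of the linear ($A$-type) chain with nodes $0,1,\dots,p-1$ (node $0$ carrying $N_0=n$), and the couplings change by the corresponding reflection $$\lambda'_{j-1}=\lambda_{j-1}+\lambda_j,\qquad \lambda'_j=-\lambda_j,\qquad \lambda'_{j+1}=\lambda_{j+1}+\lambda_j,\qquad \lambda'_\ell=\lambda_\ell\ (\ell\neq j-1,j,j+1),$$ where for $j=1$ the coupling $\lambda_0$ attached to node $0$ is any quantity of the form $c+w_1$ (with $c$ independent of the ordering) and $\lambda'_0=c+w'_1=c+w_2=\lambda_0+\lambda_1$, and where couplings with indices outside $0,\dots,p-1$ are ignored.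
   Context: In the paper, for a Fuchsian system with residue matrix $A_i$ at a marked point $z_i$, the data $(N_{i,k})$ are the dimensions of the filtration of the fiber, attached to the nodes $\bullet_{i,k}$ of the $i$-th branch of a star-shaped quiver whose central node $\star$ carries $n$; the Fayet–Iliopoulos coupling at $\bullet_{i,\ell}$ ($\ell\ge1$) is $\lambda_{i,\ell}=w_{i,\ell+1}-w_{i,\ell}$ and at the central node it is $\lambda_\star=\sum_i w_{i,1}$. The (Seiberg duality $=$) Weyl reflection at a simple root $\alpha_\sigma$ with $\lambda_\sigma\neq0$ acts by $\boldsymbol{N}\mapsto \boldsymbol{N}-\langle\boldsymbol{N},\alpha_\sigma\rangle\alpha_\sigma$ and $\lambda_\tau\mapsto\lambda_\tau-\langle\alpha_\tau,\alpha_\sigma\rangle\lambda_\sigma$, where $\langle-,-\rangle$ is the symmetric bilinear form given by the Cartan matrix of the (star-shaped) graph ($2$ on the diagonal, $-1$ for adjacent nodes, $0$ otherwise). The paper's statement is phrased as: the reflection at node $\bullet_{i,\ell}$ (with $\lambda_{i,\ell}\neq 0$) has the effect of interchanging the order of the two factors $(w-w_{i,\ell})$ and $(w-w_{i,\ell+1})$ of $P_i(w)$; the claim above is this statement written out on dimension vectors and couplings. *)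

theory Defs
  imports "HOL-Analysis.Analysis"
begin

text \<open>Ordered product (A - w 1)(A - w 2)...(A - w k) of linear factors evaluated at A.\<close>
fun facprod :: "(nat \<Rightarrow> complex) \<Rightarrow> complex^'n^'n \<Rightarrow> nat \<Rightarrow> complex^'n^'n" where
  "facprod w A 0 = mat 1"
| "facprod w A (Suc k) = facprod w A k ** (A - mat (w (Suc k)))"

text \<open>N_k = complex dimension of E_k = image of the k-th partial product acting on C^n.\<close>
definition Ndim :: "(nat \<Rightarrow> complex) \<Rightarrow> complex^'n^'n \<Rightarrow> nat \<Rightarrow> nat" where
  "Ndim w A k = vec.dim (range (\<lambda>x. facprod w A k *v x))"

text \<open>Couplings: node 0 carries c + w 1, node l >= 1 carries w (l+1) - w l.\<close>
definition coupling :: "complex \<Rightarrow> (nat \<Rightarrow> complex) \<Rightarrow> nat \<Rightarrow> complex" where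
  "coupling c w l = (if l = 0 then c + w 1 else w (Suc l) - w l)"

text \<open>Ordering with the j-th and (j+1)-th roots interchanged.\<close>
definition swap_roots :: "(nat \<Rightarrow> complex) \<Rightarrow> nat \<Rightarrow> nat \<Rightarrow> complex" where
  "swap_roots w j = w(j := w (Suc j), Suc j := w j)"

end

theory Submission
  imports Defs
begin

text \<open>
  The factors \<open>A - w\<^sub>k\<close> commute, so swapping the \<open>j\<close>-th and \<open>(j+1)\<close>-th of them changes only the
  \<open>j\<close>-th partial product. Let \<open>V = E\<^sub>j\<^sub>-\<^sub>1\<close>, an \<open>A\<close>-invariant subspace, \<open>M = A - w\<^sub>j\<close> and
  \<open>N = A - w\<^sub>j\<^sub>+\<^sub>1\<close>. Then \<open>E\<^sub>j = M V\<close>, \<open>E'\<^sub>j = N V\<close> and \<open>E\<^sub>j\<^sub>+\<^sub>1 = N M V\<close>. Since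
  \<open>M - N = (w\<^sub>j\<^sub>+\<^sub>1 - w\<^sub>j) I\<close> is invertible when \<open>\<lambda>\<^sub>j \<noteq> 0\<close>, the subspaces \<open>M V\<close> and \<open>N V\<close> span \<open>V\<close>
  and meet exactly in \<open>N M V\<close>, and Grassmann's formula gives \<open>N\<^sub>j + N'\<^sub>j = N\<^sub>j\<^sub>-\<^sub>1 + N\<^sub>j\<^sub>+\<^sub>1\<close>.
\<close>

lemma matrix_vector_mult_mat: "mat c *v x = c *s (x :: 'a::semiring_1^'n)"
  by (simp add: vec_eq_iff matrix_vector_mult_def mat_def if_distrib if_distribR sum.delta
      cong: if_cong)

lemma matrix_vector_mult_shift: "(A - mat c) *v x = A *v x - c *s (x :: 'a::ring_1^'n)"
  by (simp add: matrix_vector_mult_diff_rdistrib matrix_vector_mult_mat)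

lemma shift_matrices_commute:
  fixes A :: "'a::field^'n^'n"
  shows "(A - mat a) *v ((A - mat b) *v x) = (A - mat b) *v ((A - mat a) *v x)"
  unfolding matrix_vector_mult_shift
  by (simp add: matrix_vector_mult_diff_distrib vector_scalar_commute vec_eq_iff algebra_simps)

lemma shift_matrices_mult_commute:
  fixes A :: "'a::field^'n^'n"
  shows "(A - mat a) ** (A - mat b) = (A - mat b) ** (A - mat a)"
  by (simp add: matrix_eq matrix_vector_mul_assoc[symmetric] shift_matrices_commute)

lemma shift_matrices_diff:
  fixes A :: "'a::field^'n^'n"
  shows "(A - mat a) *v x - (A - mat b) *v x = (b - a) *s x"
  unfolding matrix_vector_mult_shift by (simp add: vec_eq_iff algebra_simps)

lemma invariant_subspace_shift:
  fixes A :: "'a::field^'n^'n"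
  assumes "vec.subspace V" "\<And>v. v \<in> V \<Longrightarrow> A *v v \<in> V" "v \<in> V"
  shows "(A - mat c) *v v \<in> V"
  using assms by (simp add: matrix_vector_mult_shift vec.subspace_diff vec.subspace_scale)

lemma shift_images_sum:
  fixes A :: "'a::field^'n^'n"
  assumes V: "vec.subspace V" and inv: "\<And>v. v \<in> V \<Longrightarrow> A *v v \<in> V" and "a \<noteq> b"
  shows "{x + y |x y. x \<in> (*v) (A - mat a) ` V \<and> y \<in> (*v) (A - mat b) ` V} = V"
proof (intro equalityI subsetI)
  fix v assume "v \<in> {x + y |x y. x \<in> (*v) (A - mat a) ` V \<and> y \<in> (*v) (A - mat b) ` V}"
  then show "v \<in> V"
    using invariant_subspace_shift[OF V inv] by (auto intro: vec.subspace_add[OF V])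
next
  fix v assume v: "v \<in> V"
  define u where "u = inverse (b - a) *s v"
  have u: "u \<in> V" "- u \<in> V"
    using v V by (auto simp: u_def intro: vec.subspace_scale vec.subspace_neg)
  have "v = (A - mat a) *v u - (A - mat b) *v u"
    using \<open>a \<noteq> b\<close> by (simp add: shift_matrices_diff u_def)
  also have "\<dots> = (A - mat a) *v u + (A - mat b) *v (- u)"
    by (metis diff_conv_add_uminus diff_0 matrix_vector_mult_0_right matrix_vector_mult_diff_distrib)
  finally show "v \<in> {x + y |x y. x \<in> (*v) (A - mat a) ` V \<and> y \<in> (*v) (A - mat b) ` V}"
    using u by blast
qed

lemma shift_images_Int:
  fixes A :: "'a::field^'n^'n"
  assumes V: "vec.subspace V" and inv: "\<And>v. v \<in> V \<Longrightarrow> A *v v \<in> V" and "a \<noteq> b"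
  shows "(*v) (A - mat a) ` V \<inter> (*v) (A - mat b) ` V = (*v) (A - mat b) ` (*v) (A - mat a) ` V"
    (is "(*v) ?M ` V \<inter> (*v) ?N ` V = _")
proof (intro equalityI subsetI)
  fix u assume "u \<in> (*v) ?M ` V \<inter> (*v) ?N ` V"
  then obtain v1 v2 where v: "v1 \<in> V" "v2 \<in> V" "u = ?M *v v1" "u = ?N *v v2" by blast
  define d where "d = inverse (b - a)"
  have "u = ?M *v (d *s u) - ?N *v (d *s u)"
    using \<open>a \<noteq> b\<close> by (simp add: shift_matrices_diff d_def)
  also have "\<dots> = ?N *v (?M *v (d *s v2)) - ?N *v (?M *v (d *s v1))"
  proof -
    have "?M *v (d *s u) = ?N *v (?M *v (d *s v2))"
      by (simp add: v(4) vector_scalar_commute shift_matrices_commute[of A a b])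
    moreover have "?N *v (d *s u) = ?N *v (?M *v (d *s v1))"
      by (simp add: v(3) vector_scalar_commute)
    ultimately show ?thesis by simp
  qed
  also have "\<dots> = ?N *v (?M *v (d *s v2 - d *s v1))"
    by (simp add: matrix_vector_mult_diff_distrib)
  finally have "u = ?N *v (?M *v (d *s v2 - d *s v1))" .
  moreover have "d *s v2 - d *s v1 \<in> V"
    using v V by (auto intro!: vec.subspace_diff vec.subspace_scale)
  ultimately show "u \<in> (*v) ?N ` (*v) ?M ` V" by blast
next
  fix u assume "u \<in> (*v) ?N ` (*v) ?M ` V"
  then obtain v where v: "v \<in> V" "u = ?N *v (?M *v v)" by blast
  then have "u = ?M *v (?N *v v)"
    by (simp add: shift_matrices_commute[of A a b])
  then show "u \<in> (*v) ?M ` V \<inter> (*v) ?N ` V"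
    using v invariant_subspace_shift[OF V inv] by blast
qed

lemma dim_shift_images:
  fixes A :: "'a::field^'n^'n"
  assumes V: "vec.subspace V" and inv: "\<And>v. v \<in> V \<Longrightarrow> A *v v \<in> V" and "a \<noteq> b"
  shows "vec.dim ((*v) (A - mat a) ` V) + vec.dim ((*v) (A - mat b) ` V)
       = vec.dim V + vec.dim ((*v) (A - mat b) ` (*v) (A - mat a) ` V)"
  using vec.dim_sums_Int[OF vec.subspace_image[OF V, of "A - mat a"] vec.subspace_image[OF V, of "A - mat b"]]
  by (simp add: shift_images_sum[OF assms] shift_images_Int[OF assms])

lemma facprod_commute: "facprod w A k *v (A *v x) = A *v (facprod w A k *v x)"
proof (induction k arbitrary: x)
  case 0
  then show ?case by simp
next
  case (Suc k)
  then show ?case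
    by (simp add: matrix_vector_mul_assoc[symmetric] matrix_vector_mult_shift
        matrix_vector_mult_diff_distrib vector_scalar_commute)
qed

lemma facprod_commute_shift:
  "facprod w A k *v ((A - mat c) *v x) = (A - mat c) *v (facprod w A k *v x)"
  by (simp add: matrix_vector_mult_shift matrix_vector_mult_diff_distrib vector_scalar_commute
      facprod_commute)

lemma range_facprod_Suc:
  "range ((*v) (facprod w A (Suc k))) = (*v) (A - mat (w (Suc k))) ` range ((*v) (facprod w A k))"
proof -
  have "(*v) (facprod w A (Suc k)) = (\<lambda>x. (A - mat (w (Suc k))) *v (facprod w A k *v x))"
    by (simp add: fun_eq_iff matrix_vector_mul_assoc[symmetric] facprod_commute_shift)
  then show ?thesis by (simp add: image_image)
qed

lemma subspace_range_facprod: "vec.subspace (range ((*v) (facprod w A k)))"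
  using vec.subspace_image[OF vec.subspace_UNIV] by simp

lemma range_facprod_invariant:
  "v \<in> range ((*v) (facprod w A k)) \<Longrightarrow> A *v v \<in> range ((*v) (facprod w A k))"
  by (auto simp: facprod_commute[symmetric])

lemma swap_roots_simps [simp]:
  "swap_roots w j j = w (Suc j)"
  "swap_roots w j (Suc j) = w j"
  "k \<noteq> j \<Longrightarrow> k \<noteq> Suc j \<Longrightarrow> swap_roots w j k = w k"
  by (simp_all add: swap_roots_def)

lemma facprod_swap_roots_below: "k < j \<Longrightarrow> facprod (swap_roots w j) A k = facprod w A k"
  by (induction k) simp_all

lemma facprod_swap_roots_above:
  assumes "0 < j" "Suc j \<le> k"
  shows "facprod (swap_roots w j) A k = facprod w A k"
  using assms(2)
proof (induction k rule: dec_induct)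
  case base
  obtain i where i: "j = Suc i" using \<open>0 < j\<close> by (cases j) auto
  have "facprod (swap_roots w j) A (Suc j)
      = facprod w A i ** ((A - mat (w (Suc j))) ** (A - mat (w j)))"
    using facprod_swap_roots_below[of i j w A] by (simp add: i matrix_mul_assoc)
  also have "\<dots> = facprod w A (Suc j)"
    by (simp add: i matrix_mul_assoc shift_matrices_mult_commute[of A "w (Suc (Suc i))"])
  finally show ?case .
next
  case (step k)
  then show ?case by simp
qed

lemma Ndim_swap_roots:
  assumes "0 < j" "k \<noteq> j"
  shows "Ndim (swap_roots w j) A k = Ndim w A k"
  using assms
  by (cases "k < j") (simp_all add: Ndim_def facprod_swap_roots_below facprod_swap_roots_above)

lemma Ndim_swap_roots_reflection:
  fixes A :: "complex^'n^'n"
  assumes "0 < j" "w j \<noteq> w (Suc j)"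
  shows "Ndim w A j + Ndim (swap_roots w j) A j = Ndim w A (j - 1) + Ndim w A (Suc j)"
proof -
  obtain i where i: "j = Suc i" using \<open>0 < j\<close> by (cases j) auto
  define V where "V = range ((*v) (facprod w A i))"
  have "range ((*v) (facprod w A j)) = (*v) (A - mat (w j)) ` V"
    by (simp add: V_def i range_facprod_Suc del: facprod.simps)
  moreover have "range ((*v) (facprod (swap_roots w j) A j)) = (*v) (A - mat (w (Suc j))) ` V"
    using facprod_swap_roots_below[of i j w A]
    by (simp add: V_def i range_facprod_Suc del: facprod.simps)
  moreover have "range ((*v) (facprod w A (Suc j)))
      = (*v) (A - mat (w (Suc j))) ` (*v) (A - mat (w j)) ` V"
    by (simp add: V_def i range_facprod_Suc del: facprod.simps)
  ultimately show ?thesis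
    using dim_shift_images[OF subspace_range_facprod range_facprod_invariant assms(2)]
    by (simp add: Ndim_def V_def i)
qed

lemma coupling_swap_roots:
  assumes "0 < j"
  shows "coupling c (swap_roots w j) (j - 1) = coupling c w (j - 1) + coupling c w j"
    and "coupling c (swap_roots w j) j = - coupling c w j"
    and "coupling c (swap_roots w j) (Suc j) = coupling c w (Suc j) + coupling c w j"
    and "l \<notin> {j - 1, j, Suc j} \<Longrightarrow> coupling c (swap_roots w j) l = coupling c w l"
  using assms by (auto simp: coupling_def swap_roots_def le_Suc_eq)

theorem mainTheorem1:
  fixes A :: "complex^'n^'n" and w :: "nat \<Rightarrow> complex" and p j :: nat and c :: complex
  assumes PA: "facprod w A p = 0"
    and j: "1 \<le> j" "j \<le> p - 1"
    and lam: "coupling c w j \<noteq> 0"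
  shows "(\<forall>k \<le> p. k \<noteq> j \<longrightarrow> Ndim (swap_roots w j) A k = Ndim w A k)
    \<and> int (Ndim (swap_roots w j) A j)
        = int (Ndim w A (j - 1)) + int (Ndim w A (Suc j)) - int (Ndim w A j)
    \<and> coupling c (swap_roots w j) (j - 1) = coupling c w (j - 1) + coupling c w j
    \<and> coupling c (swap_roots w j) j = - coupling c w j
    \<and> (Suc j \<le> p - 1 \<longrightarrow>
         coupling c (swap_roots w j) (Suc j) = coupling c w (Suc j) + coupling c w j)
    \<and> (\<forall>l \<le> p - 1. l \<noteq> j - 1 \<and> l \<noteq> j \<and> l \<noteq> Suc j \<longrightarrow>
         coupling c (swap_roots w j) l = coupling c w l)"
proof -
  have "0 < j" using j(1) by simp
  moreover have "w j \<noteq> w (Suc j)" using lam j(1) by (simp add: coupling_def)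
  ultimately have "Ndim w A j + Ndim (swap_roots w j) A j = Ndim w A (j - 1) + Ndim w A (Suc j)"
    by (rule Ndim_swap_roots_reflection)
  then show ?thesis
    using Ndim_swap_roots[OF \<open>0 < j\<close>] coupling_swap_roots[OF \<open>0 < j\<close>] by auto
qed

end
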